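(* Let $r,n\ge 1$ be integers, and let $v_n=\mathrm{lcm}\{1,\dots,n\}$. Let $\phi\in\mathcal S(\mathbb R)$ be an even real-valued function such that, for every integer $k\ge 0$, $\phi^{(k)}(0)\neq 0$ if and only if $k$ is even. Define, for $t\in\mathbb R$, $$\phi_n(t):=\phi(t^{v_n}),\qquad \phi_{n,r}(t):=\frac{1}{(2rv_n)!}\,\phi_n^{(2rv_n)}(t),\qquad \tilde\phi_{n,r}(t):=\phi_{n,r}\big(|t|^{1/v_n}\big),\qquad g(t):=(1+t)\,\tilde\phi_{n,r}(t).$$ Let $h\in\mathcal S(\mathbb R)$ with $\int_{\mathbb R}h(t)\,dt\ne 0$, and put $\tau:=g\otimes h$, i.e. $\tau(x_1,x_2)=g(x_1)h(x_2)$. Then: (i) $\tau\in\mathcal S(\mathbb R^2)$. (ii) $\tau$ is an analyzing Taylorlet of order $n$ with $2r-1$ vanishing moments. (iii) $\tau$ is restrictive (as an analyzing Taylorlet of order $n$ with $2r-1$ vanishing moments).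
   Context: $\mathcal S(\mathbb R^d)$ denotes the Schwartz space. Iterated integrals: for $\varphi\in L^1(\mathbb R)$, $I_+\varphi(u):=\int_{-\infty}^u\varphi(v)\,dv$, $I_+^0\varphi:=\varphi$, and $I_+^{k+1}\varphi:=I_+(I_+^k\varphi)$. Vanishing moments of higher order: let $R\ge 1$. A function $f:\mathbb R\to\mathbb R$ has $R$ vanishing moments of order $n$ if, for both choices of sign, $\int_{\mathbb R} f(\pm t^k)\,t^m\,dt=0$ for all $k\in\{1,\dots,n\}$ and all $m\in\{0,\dots,kR-1\}$. Analyzing Taylorlet: if $g,h\in\mathcal S(\mathbb R)$ and $g$ has $R$ vanishing moments of order $n$, then $\tau=g\otimes h$ is called an analyzing Taylorlet of order $n$ with $R$ vanishing moments. It is called restrictive if additionally $I_+^j g(0)\neq 0$ for all $j\in\{0,\dots,R\}$ and $\int_{\mathbb R}h(t)\,dt\ne 0$. *)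

theory Defs
  imports "HOL-Analysis.Analysis"
begin

text \<open>Iterated partial derivatives, where \<open>bs\<close> lists the directions of differentiation; repetitions
  encode higher order, so lists over \<open>Basis\<close> play the role of multi-indices.\<close>

fun partial_derivs :: "'a list \<Rightarrow> ('a::euclidean_space \<Rightarrow> 'b::real_normed_vector) \<Rightarrow> 'a \<Rightarrow> 'b" where
  "partial_derivs [] f = f"
| "partial_derivs (b # bs) f = (\<lambda>x. frechet_derivative (partial_derivs bs f) (at x) b)"

text \<open>The first conjunct is \<open>C\<^sup>\<infinity>\<close> smoothness: all iterated partial derivatives exist and are
  differentiable, hence continuous. It also ensures that \<^const>\<open>frechet_derivative\<close> above is the
  actual derivative.\<close>

definition schwartz :: "('a::euclidean_space \<Rightarrow> 'b::real_normed_vector) \<Rightarrow> bool" where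
  "schwartz f \<longleftrightarrow>
     (\<forall>bs. set bs \<subseteq> Basis \<longrightarrow> (\<forall>x. partial_derivs bs f differentiable (at x))) \<and>
     (\<forall>bs k. set bs \<subseteq> Basis \<longrightarrow> bounded (range (\<lambda>x. norm x ^ k *\<^sub>R partial_derivs bs f x)))"

definition I_plus :: "(real \<Rightarrow> real) \<Rightarrow> real \<Rightarrow> real" where
  "I_plus f u = (LINT v:{..u}|lborel. f v)"

text \<open>\<^const>\<open>has_bochner_integral\<close> includes integrability, so a moment cannot vanish merely because
  its integral is undefined.\<close>

definition has_vanishing_moments :: "nat \<Rightarrow> nat \<Rightarrow> (real \<Rightarrow> real) \<Rightarrow> bool" where
  "has_vanishing_moments R n f \<longleftrightarrow>
     (\<forall>s\<in>{1, -1}. \<forall>k\<in>{1..n}. \<forall>m<k * R.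
        has_bochner_integral lborel (\<lambda>t. f (s * t ^ k) * t ^ m) 0)"

definition tensor :: "(real \<Rightarrow> real) \<Rightarrow> (real \<Rightarrow> complex) \<Rightarrow> real \<times> real \<Rightarrow> complex" where
  "tensor g h = (\<lambda>(x1, x2). complex_of_real (g x1) * h x2)"

text \<open>Being an analyzing or a restrictive Taylorlet is expressed through the factors of
  \<open>\<tau>\<close>, so the factors are arguments of the predicates.\<close>

definition analyzing_taylorlet ::
  "nat \<Rightarrow> nat \<Rightarrow> (real \<times> real \<Rightarrow> complex) \<Rightarrow> (real \<Rightarrow> real) \<Rightarrow> (real \<Rightarrow> complex) \<Rightarrow> bool" where
  "analyzing_taylorlet n R \<tau> g h \<longleftrightarrow>
     \<tau> = tensor g h \<and> schwartz g \<and> schwartz h \<and> has_vanishing_moments R n g"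

text \<open>A Bochner integral of a non-integrable function is \<open>0\<close>, so the conditions \<open>\<noteq> 0\<close> below also
  force the integrals involved to exist.\<close>

definition restrictive_taylorlet ::
  "nat \<Rightarrow> nat \<Rightarrow> (real \<times> real \<Rightarrow> complex) \<Rightarrow> (real \<Rightarrow> real) \<Rightarrow> (real \<Rightarrow> complex) \<Rightarrow> bool" where
  "restrictive_taylorlet n R \<tau> g h \<longleftrightarrow>
     analyzing_taylorlet n R \<tau> g h \<and>
     (\<forall>j\<le>R. (I_plus ^^ j) g 0 \<noteq> 0) \<and> (LINT t|lborel. h t) \<noteq> 0"

end

theory Submission
  imports Defs "HOL-Probability.Sinc_Integral"
begin

text \<open>Differentiating a function \<open>P (x ^ v)\<close> exactly \<open>v\<close> times gives a function \<open>(A P) (x ^ v)\<close>, where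
  \<open>A P = L\<^sub>1 (L\<^sub>2 (\<dots> (L\<^sub>v\<^sub>-\<^sub>1 (v P'))))\<close> with the Euler-type operators \<open>L\<^sub>c F = v t F' + c F\<close>
  (lemma \<open>deriv_funpow_compose_power\<close>). So the root in the construction of \<open>g\<close> only undoes
  the substitution \<open>t \<mapsto> t ^ v\<close>: up to a nonzero constant,
  \<open>g t = (1 + t) \<Phi> t\<close> with \<open>\<Phi> = A\<^sup>2\<^sup>r \<phi>\<close>. The operator \<open>A\<close> preserves Schwartz functions and reverses
  parity, so that \<open>\<Phi>\<close> is Schwartz and even, and the absolute value is harmless. The remaining
  properties follow from how \<open>L\<^sub>c\<close> interacts with moments and with \<open>d/dt\<close>.

  Moments: integration by parts shows that \<open>L\<^sub>c\<close> multiplies \<open>\<integral> F (\<plusminus> t ^ k) t ^ m dt\<close> by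
  \<open>c - v (m + 1) / k\<close>, while replacing \<open>F\<close> by \<open>F'\<close> lowers \<open>m\<close> by \<open>k\<close>, and gives zero for \<open>m = k - 1\<close>.
  If \<open>m + 1 < k\<close> and \<open>k\<close> divides \<open>v\<close>, then \<open>v (m + 1) / k\<close> is one of the
  shifts \<open>1, \<dots>, v - 1\<close> in \<open>A\<close>. By induction all moments of \<open>A\<^sup>b F\<close> with \<open>m < b k\<close> vanish
  (lemma \<open>power_moment_power_deriv_funpow_eq_0\<close>). The factor \<open>1 + t\<close> costs one order, which leaves
  \<open>2 r - 1\<close>. The least common multiple enters because \<open>v\<close> has to be divisible by every \<open>k \<le> n\<close>.

  Iterated integrals: since \<open>L\<^sub>c (F') = (L\<^sub>c\<^sub>-\<^sub>v F)'\<close>, all derivatives in \<open>A\<^sup>2\<^sup>r\<close> can be moved to the outside, so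
  \<open>\<Phi>\<close> is the derivative of order \<open>2 r\<close> of a Schwartz function \<open>G\<close>. The shifts that occur are never
  divisible by \<open>v\<close>, so \<open>G\<close> and \<open>\<phi>\<close> have nonzero Taylor coefficients at \<open>0\<close> in the same orders, the even ones
  (lemma \<open>power_deriv_funpow_antiderivative\<close>). With \<open>R = 2 r - 1\<close>, the function
  \<open>(1 + t) \<Phi>\<close> is the \<open>R\<close>-th derivative of \<open>(1 + t) G' - R G\<close>, and its \<open>j\<close>-fold
  integral at \<open>0\<close> is \<open>G\<^sup>(\<^sup>m\<^sup>+\<^sup>1\<^sup>) - j G\<^sup>(\<^sup>m\<^sup>)\<close> at \<open>0\<close> with \<open>m = R - j\<close>. Exactly one of these two derivatives is
  nonzero, and its coefficient is nonzero because \<open>m\<close> is even only for odd \<open>j\<close>.\<close>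

section \<open>Closure properties of Schwartz functions\<close>

text \<open>The partial derivatives of a product or of \<open>t * f t\<close> are sums that grow with the order.
  Coinduction replaces formulas for them by the choice of a class that is closed under a single
  differentiation.\<close>

lemma schwartz_coinduct:
  fixes f :: "'a::euclidean_space \<Rightarrow> 'b::real_normed_vector"
  assumes "f \<in> S"
    and diff: "\<And>f x. f \<in> S \<Longrightarrow> f differentiable (at x)"
    and closed: "\<And>f b. f \<in> S \<Longrightarrow> b \<in> Basis \<Longrightarrow> (\<lambda>x. frechet_derivative f (at x) b) \<in> S"
    and decay: "\<And>f k. f \<in> S \<Longrightarrow> bounded (range (\<lambda>x. norm x ^ k *\<^sub>R f x))"
  shows "schwartz f"
proof -
  have "partial_derivs bs f \<in> S" if "set bs \<subseteq> Basis" for bs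
    using that by (induction bs) (auto simp: \<open>f \<in> S\<close> intro!: closed)
  with diff decay show ?thesis
    unfolding schwartz_def by blast
qed

lemma schwartz_differentiable: "schwartz f \<Longrightarrow> f differentiable (at x)"
  unfolding schwartz_def by (metis empty_subsetI list.set(1) partial_derivs.simps(1))

lemma schwartz_bounded: "schwartz f \<Longrightarrow> bounded (range (\<lambda>x. norm x ^ k *\<^sub>R f x))"
  unfolding schwartz_def by (metis empty_subsetI list.set(1) partial_derivs.simps(1))

lemma partial_derivs_snoc:
  "partial_derivs (bs @ [b]) f = partial_derivs bs (\<lambda>x. frechet_derivative f (at x) b)"
  by (induction bs) auto

lemma schwartz_frechet_derivative:
  assumes "schwartz f" "b \<in> Basis"
  shows "schwartz (\<lambda>x. frechet_derivative f (at x) b)"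
proof -
  have "set (bs @ [b]) \<subseteq> Basis" if "set bs \<subseteq> Basis" for bs
    using that assms(2) by auto
  then show ?thesis
    using assms(1) unfolding schwartz_def partial_derivs_snoc[symmetric] by blast
qed

lemma schwartz_real_coinduct:
  fixes f :: "real \<Rightarrow> real"
  assumes "f \<in> S"
    and deriv: "\<And>f. f \<in> S \<Longrightarrow> \<exists>f'\<in>S. \<forall>x. (f has_real_derivative f' x) (at x)"
    and decay: "\<And>f k. f \<in> S \<Longrightarrow> \<exists>C. \<forall>x. \<bar>x\<bar> ^ k * \<bar>f x\<bar> \<le> C"
  shows "schwartz f"
proof (rule schwartz_coinduct[OF \<open>f \<in> S\<close>])
  fix f assume "f \<in> S"
  then obtain f' where f': "f' \<in> S" "\<And>x. (f has_real_derivative f' x) (at x)"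
    using deriv by blast
  then have fd: "(f has_derivative (*) (f' x)) (at x)" for x
    by (simp add: has_field_derivative_def)
  show "f differentiable (at x)" for x
    using fd by (rule differentiableI)
  have "frechet_derivative f (at x) = (*) (f' x)" for x
    using frechet_derivative_at[OF fd] by simp
  then show "(\<lambda>x. frechet_derivative f (at x) b) \<in> S" if "b \<in> Basis" for b
    using that f' by simp
  show "bounded (range (\<lambda>x. norm x ^ k *\<^sub>R f x))" for k
    using decay[OF \<open>f \<in> S\<close>, of k] by (auto simp: bounded_iff abs_mult power_abs)
qed

lemma schwartz_DERIV:
  fixes f :: "real \<Rightarrow> real"
  assumes "schwartz f"
  shows "(f has_real_derivative deriv f x) (at x)"
  using schwartz_differentiable[OF assms]
  by (metis DERIV_deriv_iff_real_differentiable)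

lemma schwartz_deriv:
  fixes f :: "real \<Rightarrow> real"
  assumes "schwartz f"
  shows "schwartz (deriv f)"
proof -
  have "frechet_derivative f (at x) = (*) (deriv f x)" for x
    using frechet_derivative_at[of f "(*) (deriv f x)"] schwartz_DERIV[OF assms]
    by (simp add: has_field_derivative_def)
  then have "(\<lambda>x. frechet_derivative f (at x) 1) = deriv f"
    by simp
  then show ?thesis
    using schwartz_frechet_derivative[OF assms, of 1] by simp
qed

lemma schwartz_deriv_funpow:
  fixes f :: "real \<Rightarrow> real"
  shows "schwartz f \<Longrightarrow> schwartz ((deriv ^^ k) f)"
  by (induction k) (auto intro: schwartz_deriv)

lemma schwartz_decay:
  assumes "schwartz f"
  shows "\<exists>C. \<forall>x. norm x ^ k * norm (f x) \<le> C"
  using schwartz_bounded[OF assms, of k] by (auto simp: bounded_iff)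

lemma schwartz_scaled_add:
  fixes f g :: "real \<Rightarrow> real"
  assumes "schwartz f" "schwartz g"
  shows "schwartz (\<lambda>t. a * f t + g t)"
proof (rule schwartz_real_coinduct[where S = "{\<lambda>t. a * f t + g t | f g. schwartz f \<and> schwartz g}"])
  show "(\<lambda>t. a * f t + g t) \<in> {\<lambda>t. a * f t + g t | f g. schwartz f \<and> schwartz g}"
    using assms by blast
next
  fix u :: "real \<Rightarrow> real" assume "u \<in> {\<lambda>t. a * f t + g t | f g. schwartz f \<and> schwartz g}"
  then obtain f g where u: "u = (\<lambda>t. a * f t + g t)" and fg: "schwartz f" "schwartz g"
    by blast
  have "(\<lambda>t. a * deriv f t + deriv g t) \<in> {\<lambda>t. a * f t + g t | f g. schwartz f \<and> schwartz g}"
    using fg schwartz_deriv by blast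
  moreover have "(u has_real_derivative a * deriv f x + deriv g x) (at x)" for x
    unfolding u by (auto intro!: derivative_eq_intros schwartz_DERIV fg)
  ultimately show "\<exists>u'\<in>{\<lambda>t. a * f t + g t | f g. schwartz f \<and> schwartz g}.
      \<forall>x. (u has_real_derivative u' x) (at x)"
    by (intro bexI) auto
  fix k
  obtain C D where C: "\<And>x. \<bar>x\<bar> ^ k * \<bar>f x\<bar> \<le> C" and D: "\<And>x. \<bar>x\<bar> ^ k * \<bar>g x\<bar> \<le> D"
    using schwartz_decay[OF fg(1), of k] schwartz_decay[OF fg(2), of k] by auto
  have "\<bar>x\<bar> ^ k * \<bar>u x\<bar> \<le> \<bar>a\<bar> * C + D" for x
  proof -
    have "\<bar>x\<bar> ^ k * \<bar>u x\<bar> \<le> \<bar>x\<bar> ^ k * (\<bar>a\<bar> * \<bar>f x\<bar> + \<bar>g x\<bar>)"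
      unfolding u by (intro mult_left_mono) (auto simp flip: abs_mult)
    also have "\<dots> = \<bar>a\<bar> * (\<bar>x\<bar> ^ k * \<bar>f x\<bar>) + \<bar>x\<bar> ^ k * \<bar>g x\<bar>"
      by (simp add: algebra_simps)
    also have "\<dots> \<le> \<bar>a\<bar> * C + D"
      by (intro add_mono mult_left_mono C D) auto
    finally show ?thesis .
  qed
  then show "\<exists>C. \<forall>x. \<bar>x\<bar> ^ k * \<bar>u x\<bar> \<le> C" by blast
qed

lemma schwartz_zero: "schwartz (\<lambda>t::real. 0::real)"
  by (rule schwartz_real_coinduct[where S = "{\<lambda>t. 0}"]) (auto intro: exI[of _ 0])

lemma schwartz_scale:
  fixes f :: "real \<Rightarrow> real"
  shows "schwartz f \<Longrightarrow> schwartz (\<lambda>t. a * f t)"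
  using schwartz_scaled_add[OF _ schwartz_zero] by simp

lemma schwartz_add:
  fixes f g :: "real \<Rightarrow> real"
  shows "schwartz f \<Longrightarrow> schwartz g \<Longrightarrow> schwartz (\<lambda>t. f t + g t)"
  using schwartz_scaled_add[of f g 1] by simp

text \<open>The derivative of \<open>t * f t\<close> is \<open>t * f' t + f t\<close>, so a class closed under
  differentiation has to allow for an additional Schwartz summand.\<close>

lemma schwartz_times_id:
  fixes f :: "real \<Rightarrow> real"
  assumes "schwartz f"
  shows "schwartz (\<lambda>t. t * f t)"
proof (rule schwartz_real_coinduct[where S = "{\<lambda>t. t * f t + g t | f g. schwartz f \<and> schwartz g}"])
  have "(\<lambda>t. t * f t) = (\<lambda>t. t * f t + 0)" by simp
  then show "(\<lambda>t. t * f t) \<in> {\<lambda>t. t * f t + g t | f g. schwartz f \<and> schwartz g}"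
    using assms schwartz_zero by (intro CollectI exI[of _ f] exI[of _ "\<lambda>t. 0"]) simp
next
  fix u :: "real \<Rightarrow> real" assume "u \<in> {\<lambda>t. t * f t + g t | f g. schwartz f \<and> schwartz g}"
  then obtain f g where u: "u = (\<lambda>t. t * f t + g t)" and fg: "schwartz f" "schwartz g"
    by blast
  have "schwartz (\<lambda>t. f t + deriv g t)"
    using fg by (intro schwartz_add schwartz_deriv)
  then have "(\<lambda>t. t * deriv f t + (f t + deriv g t)) \<in>
      {\<lambda>t. t * f t + g t | f g. schwartz f \<and> schwartz g}"
    using schwartz_deriv[OF fg(1)] by (intro CollectI exI[of _ "deriv f"]
        exI[of _ "\<lambda>t. f t + deriv g t"]) simp
  moreover have "(u has_real_derivative x * deriv f x + (f x + deriv g x)) (at x)" for x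
    unfolding u by (auto intro!: derivative_eq_intros schwartz_DERIV fg)
  ultimately show "\<exists>u'\<in>{\<lambda>t. t * f t + g t | f g. schwartz f \<and> schwartz g}.
      \<forall>x. (u has_real_derivative u' x) (at x)"
    by (intro bexI) auto
  fix k
  obtain C D where C: "\<And>x. \<bar>x\<bar> ^ Suc k * \<bar>f x\<bar> \<le> C" and D: "\<And>x. \<bar>x\<bar> ^ k * \<bar>g x\<bar> \<le> D"
    using schwartz_decay[OF fg(1), of "Suc k"] schwartz_decay[OF fg(2), of k]
    unfolding real_norm_def by blast
  have "\<bar>x\<bar> ^ k * \<bar>u x\<bar> \<le> C + D" for x
  proof -
    have "\<bar>x\<bar> ^ k * \<bar>u x\<bar> \<le> \<bar>x\<bar> ^ k * (\<bar>x\<bar> * \<bar>f x\<bar> + \<bar>g x\<bar>)"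
      unfolding u by (intro mult_left_mono) (auto simp flip: abs_mult)
    also have "\<dots> = \<bar>x\<bar> ^ Suc k * \<bar>f x\<bar> + \<bar>x\<bar> ^ k * \<bar>g x\<bar>"
      by (simp add: algebra_simps)
    also have "\<dots> \<le> C + D"
      by (intro add_mono C D)
    finally show ?thesis .
  qed
  then show "\<exists>C. \<forall>x. \<bar>x\<bar> ^ k * \<bar>u x\<bar> \<le> C" by blast
qed

text \<open>The partial derivatives of \<open>g \<otimes> h\<close> are \<open>g' \<otimes> h\<close> and \<open>g \<otimes> h'\<close>, so the tensor products of
  Schwartz functions form a class to which coinduction applies. Decay uses
  \<open>\<parallel>(x, y)\<parallel> \<le> 2 max \<bar>x\<bar> \<bar>y\<bar>\<close>.\<close>

lemma schwartz_tensor: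
  assumes "schwartz g" "schwartz h"
  shows "schwartz (tensor g h)"
proof (rule schwartz_coinduct[where S = "{tensor g h | g h. schwartz g \<and> schwartz h}"])
  show "tensor g h \<in> {tensor g h | g h. schwartz g \<and> schwartz h}"
    using assms by blast
next
  fix f :: "real \<times> real \<Rightarrow> complex"
  assume "f \<in> {tensor g h | g h. schwartz g \<and> schwartz h}"
  then obtain g h where f: "f = tensor g h" and gh: "schwartz g" "schwartz h"
    by blast
  define h' where "h' = (\<lambda>x. frechet_derivative h (at x) 1)"
  have h': "schwartz h'"
    unfolding h'_def using gh by (intro schwartz_frechet_derivative) auto
  have hd: "(h has_derivative (\<lambda>y. y *\<^sub>R h' x)) (at x)" for x
  proof -
    have *: "(h has_derivative frechet_derivative h (at x)) (at x)"
      using schwartz_differentiable[OF gh(2)] frechet_derivative_works by blast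
    have "frechet_derivative h (at x) y = y *\<^sub>R h' x" for y
      unfolding h'_def using linear_scale[OF has_derivative_linear[OF *], of y 1]
      by (simp only: real_scaleR_def mult_1_right)
    then have "frechet_derivative h (at x) = (\<lambda>y. y *\<^sub>R h' x)"
      by blast
    with * show ?thesis by simp
  qed
  have gd: "(g has_derivative (\<lambda>y. y * deriv g x)) (at x)" for x
    using schwartz_DERIV[OF gh(1), of x] by (simp add: has_field_derivative_def mult_commute_abs)
  have fd: "(f has_derivative (\<lambda>(a, b). complex_of_real (a * deriv g (fst z)) * h (snd z) +
      complex_of_real (g (fst z)) * (b *\<^sub>R h' (snd z)))) (at z)" for z
  proof -
    have 1: "((\<lambda>z. g (fst z)) has_derivative (\<lambda>y. fst y * deriv g (fst z))) (at z)"
      by (rule has_derivative_compose[OF has_derivative_fst[OF has_derivative_ident] gd])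
    have 2: "((\<lambda>z. h (snd z)) has_derivative (\<lambda>y. snd y *\<^sub>R h' (snd z))) (at z)"
      by (rule has_derivative_compose[OF has_derivative_snd[OF has_derivative_ident] hd])
    have "f = (\<lambda>z. complex_of_real (g (fst z)) * h (snd z))"
      by (auto simp: f tensor_def)
    with has_derivative_mult[OF has_derivative_of_real[OF 1] 2] show ?thesis
      by (simp add: case_prod_unfold add.commute)
  qed
  show "f differentiable (at z)" for z
    using fd by (rule differentiableI)
  show "(\<lambda>z. frechet_derivative f (at z) b) \<in> {tensor g h | g h. schwartz g \<and> schwartz h}"
    if "b \<in> Basis" for b
  proof -
    have fr: "frechet_derivative f (at z) =
        (\<lambda>(a, b). complex_of_real (a * deriv g (fst z)) * h (snd z) +
          complex_of_real (g (fst z)) * (b *\<^sub>R h' (snd z)))" for z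
      using frechet_derivative_at[OF fd] by simp
    from that consider "b = (1, 0)" | "b = (0, 1)"
      by (auto simp: Basis_prod_def)
    then have "(\<lambda>z. frechet_derivative f (at z) b) = tensor (deriv g) h \<or>
        (\<lambda>z. frechet_derivative f (at z) b) = tensor g h'"
      by cases (auto simp: fr tensor_def fun_eq_iff)
    then show ?thesis
      using gh h' schwartz_deriv by blast
  qed
  fix k
  obtain A where A: "\<And>x. \<bar>x\<bar> ^ k * \<bar>g x\<bar> \<le> A"
    using schwartz_decay[OF gh(1), of k] by auto
  obtain B where B: "\<And>x. \<bar>g x\<bar> \<le> B"
    using schwartz_decay[OF gh(1), of 0] by auto
  obtain C where C: "\<And>y. \<bar>y\<bar> ^ k * norm (h y) \<le> C"
    using schwartz_decay[OF gh(2), of k] by auto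
  obtain D where D: "\<And>y. norm (h y) \<le> D"
    using schwartz_decay[OF gh(2), of 0] by auto
  have "norm (norm z ^ k *\<^sub>R f z) \<le> 2 ^ k * (A * D + B * C)" for z
  proof -
    obtain x y where z: "z = (x, y)" by fastforce
    have "norm z \<le> \<bar>x\<bar> + \<bar>y\<bar>"
      unfolding z using norm_Pair_le[of x y] by simp
    also have "\<dots> \<le> 2 * max \<bar>x\<bar> \<bar>y\<bar>" by auto
    finally have "norm z ^ k \<le> (2 * max \<bar>x\<bar> \<bar>y\<bar>) ^ k"
      by (intro power_mono) auto
    also have "\<dots> \<le> 2 ^ k * (\<bar>x\<bar> ^ k + \<bar>y\<bar> ^ k)"
      by (auto simp: power_mult_distrib max_def)
    finally have "norm z ^ k * (\<bar>g x\<bar> * norm (h y)) \<le>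
        2 ^ k * (\<bar>x\<bar> ^ k + \<bar>y\<bar> ^ k) * (\<bar>g x\<bar> * norm (h y))"
      by (intro mult_right_mono) auto
    also have "\<dots> = 2 ^ k * ((\<bar>x\<bar> ^ k * \<bar>g x\<bar>) * norm (h y) + \<bar>g x\<bar> * (\<bar>y\<bar> ^ k * norm (h y)))"
      by (simp add: algebra_simps)
    also have "\<dots> \<le> 2 ^ k * (A * D + B * C)"
    proof -
      have "0 \<le> A" "0 \<le> B"
        using order_trans[OF _ A[of x]] order_trans[OF _ B[of x]] by auto
      then show ?thesis
        by (intro mult_left_mono add_mono mult_mono A B C D) auto
    qed
    finally show ?thesis
      by (simp add: z f tensor_def norm_mult power_abs)
  qed
  then show "bounded (range (\<lambda>z. norm z ^ k *\<^sub>R f z))"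
    unfolding bounded_iff by blast
qed

section \<open>Integrals of rapidly decreasing functions\<close>

lemma integrable_rapidly_decreasing:
  fixes G :: "real \<Rightarrow> real"
  assumes cont: "\<And>x. isCont G x"
    and decay: "\<And>p. \<exists>C. \<forall>x. \<bar>x\<bar> ^ p * \<bar>G x\<bar> \<le> C"
  shows "integrable lborel G"
proof -
  obtain A B where A: "\<And>x. \<bar>x\<bar> ^ 0 * \<bar>G x\<bar> \<le> A" and B: "\<And>x. \<bar>x\<bar> ^ 2 * \<bar>G x\<bar> \<le> B"
    using decay[of 0] decay[of 2] by blast
  have "einterval (-\<infinity>) \<infinity> = UNIV"
    by auto
  then have "integrable lborel (\<lambda>x::real. inverse (1 + x\<^sup>2))"
    using integrable_inverse_1_plus_square by (simp add: set_integrable_def)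
  then have "integrable lborel (\<lambda>x. (A + B) * inverse (1 + x\<^sup>2))"
    by simp
  then show ?thesis
  proof (rule Bochner_Integration.integrable_bound)
    show "G \<in> borel_measurable lborel"
      using cont by (simp add: borel_measurable_continuous_onI continuous_at_imp_continuous_on)
    have "\<bar>G x\<bar> \<le> (A + B) * inverse (1 + x\<^sup>2)" for x
    proof -
      have "(1 + x\<^sup>2) * \<bar>G x\<bar> \<le> A + B"
        using A[of x] B[of x] by (simp add: algebra_simps)
      moreover have "1 + x\<^sup>2 > 0"
        by (simp add: add_pos_nonneg)
      ultimately show ?thesis
        by (simp add: field_simps)
    qed
    then show "AE x in lborel. norm (G x) \<le> norm ((A + B) * inverse (1 + x\<^sup>2))"
      by (smt (verit, best) AE_I2 real_norm_def)
  qed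
qed

lemma tendsto_0_rapidly_decreasing:
  fixes G :: "real \<Rightarrow> real"
  assumes "\<And>p. \<exists>C. \<forall>x. \<bar>x\<bar> ^ p * \<bar>G x\<bar> \<le> C"
  shows "(G \<longlongrightarrow> 0) at_infinity"
proof -
  obtain C where C: "\<And>x. \<bar>x\<bar> ^ 1 * \<bar>G x\<bar> \<le> C"
    using assms[of 1] by blast
  have lim: "((\<lambda>x. norm (C * inverse x)) \<longlongrightarrow> 0) at_infinity"
    by (intro tendsto_norm_zero tendsto_mult_right_zero tendsto_inverse_0)
  show ?thesis
  proof (rule Lim_null_comparison[OF _ lim])
    have "norm (G x) \<le> norm (C * inverse x)" if "norm x \<ge> 1" for x
    proof -
      have "\<bar>G x\<bar> \<le> C * inverse \<bar>x\<bar>"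
        using C[of x] that by (simp add: field_simps)
      also have "\<dots> \<le> \<bar>C * inverse x\<bar>"
        by (simp add: abs_mult mult_right_mono)
      finally show ?thesis by simp
    qed
    then show "\<forall>\<^sub>F x in at_infinity. norm (G x) \<le> norm (C * inverse x)"
      unfolding eventually_at_infinity by blast
  qed
qed

text \<open>Rapid decay removes the boundary terms at infinity from the fundamental theorem of calculus.\<close>

lemma integral_derivative_rapidly_decreasing:
  fixes G G' :: "real \<Rightarrow> real"
  assumes G: "\<And>x. (G has_real_derivative G' x) (at x)"
    and decay: "\<And>p. \<exists>C. \<forall>x. \<bar>x\<bar> ^ p * \<bar>G x\<bar> \<le> C"
    and cont: "\<And>x. isCont G' x"
    and int: "integrable lborel G'"
  shows "(LINT x:{..u}|lborel. G' x) = G u" and "(LINT x|lborel. G' x) = 0"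
proof -
  have lim: "(G \<longlongrightarrow> 0) at_infinity"
    by (rule tendsto_0_rapidly_decreasing[OF decay])
  have bot: "(G \<longlongrightarrow> 0) at_bot" and top: "(G \<longlongrightarrow> 0) at_top"
    using filterlim_mono[OF lim order_refl at_bot_le_at_infinity]
      filterlim_mono[OF lim order_refl at_top_le_at_infinity] by auto
  have sint: "set_integrable lborel A G'" if "A \<in> sets borel" for A
    using integrable_mult_indicator[OF _ int, of A] that by (simp add: set_integrable_def)
  have bot': "((G \<circ> real_of_ereal) \<longlongrightarrow> 0) (at_right (-\<infinity>))"
    using bot by (simp add: ereal_tendsto_simps)
  have top': "((G \<circ> real_of_ereal) \<longlongrightarrow> 0) (at_left \<infinity>)"
    using top by (simp add: ereal_tendsto_simps)
  have Gv: "(G has_vector_derivative G' x) (at x)" for x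
    using G by (simp add: has_real_derivative_iff_has_vector_derivative)
  have "(LBINT x=-\<infinity>..\<infinity>. G' x) = 0 - 0"
    by (rule interval_integral_FTC_integrable[OF _ Gv cont _ bot' top']) (auto intro: sint)
  then show "(LINT x|lborel. G' x) = 0"
    by (simp add: interval_lebesgue_integral_def set_lebesgue_integral_def)
  have u: "((G \<circ> real_of_ereal) \<longlongrightarrow> G u) (at_left (ereal u))"
    using DERIV_isCont[OF G, of u]
    by (simp add: ereal_tendsto_simps isCont_def tendsto_within_subset[where T = UNIV] filterlim_at_split)
  have "(LBINT x=-\<infinity>..ereal u. G' x) = G u - 0"
    by (rule interval_integral_FTC_integrable[OF _ Gv cont _ bot' u]) (auto intro: sint)
  moreover have "(LBINT x=-\<infinity>..ereal u. G' x) = (LINT x:{..u}|lborel. G' x)"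
    unfolding interval_lebesgue_integral_def
    by (auto intro!: set_integral_discrete_difference[where X="{u}"] simp: einterval_iff)
  ultimately show "(LINT x:{..u}|lborel. G' x) = G u"
    by simp
qed

lemma I_plus_deriv:
  assumes "schwartz F"
  shows "I_plus (deriv F) = F"
proof
  fix u
  have F': "schwartz (deriv F)"
    by (rule schwartz_deriv[OF assms])
  have "integrable lborel (deriv F)"
    by (rule integrable_rapidly_decreasing[OF DERIV_isCont[OF schwartz_DERIV[OF F']] schwartz_decay[OF F', unfolded real_norm_def]])
  then show "I_plus (deriv F) u = F u"
    unfolding I_plus_def
    by (rule integral_derivative_rapidly_decreasing(1)[OF schwartz_DERIV[OF assms]
        schwartz_decay[OF assms, unfolded real_norm_def] DERIV_isCont[OF schwartz_DERIV[OF F']]])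
qed

lemma I_plus_funpow_deriv_funpow:
  assumes "schwartz F" "j \<le> R"
  shows "(I_plus ^^ j) ((deriv ^^ R) F) = (deriv ^^ (R - j)) F"
  using assms(2)
proof (induction j)
  case (Suc j)
  then have "R - j = Suc (R - Suc j)" by simp
  with Suc show ?case
    by (simp add: I_plus_deriv schwartz_deriv_funpow[OF assms(1)])
qed simp

section \<open>Moments along powers\<close>

definition power_moment :: "real \<Rightarrow> nat \<Rightarrow> nat \<Rightarrow> (real \<Rightarrow> real) \<Rightarrow> real" where
  "power_moment s k m F = (LINT t|lborel. F (s * t ^ k) * t ^ m)"

lemma decay_power_moment_integrand:
  fixes F :: "real \<Rightarrow> real"
  assumes F: "schwartz F" and s: "\<bar>s\<bar> = 1" and k: "k \<ge> 1"
  shows "\<exists>C. \<forall>t. \<bar>t\<bar> ^ p * \<bar>F (s * t ^ k) * t ^ m\<bar> \<le> C"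
proof -
  obtain A B where A: "\<And>x. \<bar>x\<bar> ^ 0 * \<bar>F x\<bar> \<le> A" and B: "\<And>x. \<bar>x\<bar> ^ (p + m) * \<bar>F x\<bar> \<le> B"
    using schwartz_decay[OF F, of 0] schwartz_decay[OF F, of "p + m"] by auto
  have "\<bar>t\<bar> ^ p * \<bar>F (s * t ^ k) * t ^ m\<bar> \<le> A + B" for t
  proof -
    have "\<bar>t\<bar> ^ (p + m) \<le> 1 + \<bar>s * t ^ k\<bar> ^ (p + m)"
    proof (cases "\<bar>t\<bar> \<le> 1")
      case True
      then have "\<bar>t\<bar> ^ (p + m) \<le> 1" by (simp add: power_le_one)
      then show ?thesis by (smt (verit) zero_le_power abs_ge_zero)
    next
      case False
      then have "\<bar>t\<bar> ^ (p + m) \<le> \<bar>t\<bar> ^ (k * (p + m))"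
        using k by (intro power_increasing) auto
      then show ?thesis
        by (simp add: abs_mult s power_abs power_mult)
    qed
    then have "\<bar>t\<bar> ^ (p + m) * \<bar>F (s * t ^ k)\<bar> \<le>
        (1 + \<bar>s * t ^ k\<bar> ^ (p + m)) * \<bar>F (s * t ^ k)\<bar>"
      by (intro mult_right_mono) auto
    also have "\<dots> \<le> A + B"
      using A[of "s * t ^ k"] B[of "s * t ^ k"] by (simp add: algebra_simps)
    finally show ?thesis
      by (simp add: abs_mult power_abs power_add mult_ac)
  qed
  then show ?thesis by blast
qed

lemma isCont_power_moment_integrand:
  fixes F :: "real \<Rightarrow> real"
  assumes "schwartz F"
  shows "isCont (\<lambda>t. F (s * t ^ k) * t ^ m) t"
proof -
  have "isCont (\<lambda>t. s * t ^ k) t" "isCont (\<lambda>t. t ^ m) t"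
    by (auto intro!: continuous_intros)
  then show ?thesis
    using isCont_o2[OF _ DERIV_isCont[OF schwartz_DERIV[OF assms]]] isCont_mult by blast
qed

lemma integrable_power_moment_integrand:
  fixes F :: "real \<Rightarrow> real"
  assumes F: "schwartz F" and "\<bar>s\<bar> = 1" "k \<ge> 1"
  shows "integrable lborel (\<lambda>t. F (s * t ^ k) * t ^ m)"
  by (rule integrable_rapidly_decreasing[OF isCont_power_moment_integrand[OF F]
      decay_power_moment_integrand[OF assms]])

text \<open>Integration by parts: the derivative of \<open>F (s * t ^ k) * t ^ p\<close> integrates to zero. For
  \<open>p = 0\<close> the truncated exponent \<open>p - 1\<close> is harmless because of the factor \<open>p\<close>.\<close>

lemma power_moment_by_parts:
  assumes F: "schwartz F" and s: "\<bar>s\<bar> = 1" and k: "k \<ge> 1"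
  shows "s * real k * power_moment s k (p + k - 1) (deriv F) +
    real p * power_moment s k (p - 1) F = 0"
proof -
  let ?G = "\<lambda>t. F (s * t ^ k) * t ^ p"
  let ?G' = "\<lambda>t. s * real k * (deriv F (s * t ^ k) * t ^ (p + k - 1)) +
    real p * (F (s * t ^ k) * t ^ (p - 1))"
  note F' = schwartz_deriv[OF F]
  have int: "integrable lborel (\<lambda>t. deriv F (s * t ^ k) * t ^ (p + k - 1))"
    "integrable lborel (\<lambda>t. F (s * t ^ k) * t ^ (p - 1))"
    by (intro integrable_power_moment_integrand F F' s k)+
  have D: "(?G has_real_derivative ?G' t) (at t)" for t
  proof -
    have "t ^ (p + k - 1) = t ^ (k - 1) * t ^ p"
      using k by (simp add: add.commute flip: power_add)
    then have e: "?G' t = deriv F (s * t ^ k) * (s * (real k * t ^ (k - 1))) * t ^ p +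
        real p * t ^ (p - 1) * F (s * t ^ k)"
      by simp
    have "((\<lambda>t. F (s * t ^ k)) has_real_derivative
        deriv F (s * t ^ k) * (s * (real k * t ^ (k - 1)))) (at t)"
      by (rule DERIV_chain2[OF schwartz_DERIV[OF F]]) (auto intro!: derivative_eq_intros)
    moreover have "((\<lambda>t. t ^ p) has_real_derivative real p * t ^ (p - 1)) (at t)"
      by (auto intro!: derivative_eq_intros)
    ultimately show ?thesis
      unfolding e by (rule DERIV_mult)
  qed
  have cont: "isCont ?G' t" for t
    by (intro isCont_add isCont_mult[OF continuous_const] isCont_power_moment_integrand F F')
  have "(LINT t|lborel. ?G' t) = 0"
    by (rule integral_derivative_rapidly_decreasing(2)[OF D decay_power_moment_integrand[OF F s k] cont])
      (intro Bochner_Integration.integrable_add integrable_mult_right int)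
  then show ?thesis
    unfolding power_moment_def using int by simp
qed

text \<open>The operator \<open>v \<cdot> t \<cdot> d/dt + c\<close>. It describes the derivative of a function composed with a
  power: for positive integers \<open>c\<close>, \<open>d/dx (x ^ c * P (x ^ v)) = x ^ (c - 1) * (shifted_euler v c P) (x ^ v)\<close>.\<close>

definition shifted_euler :: "nat \<Rightarrow> real \<Rightarrow> (real \<Rightarrow> real) \<Rightarrow> real \<Rightarrow> real" where
  "shifted_euler v c F = (\<lambda>t. real v * (t * deriv F t) + c * F t)"

lemma schwartz_shifted_euler: "schwartz F \<Longrightarrow> schwartz (shifted_euler v c F)"
  unfolding shifted_euler_def
  by (intro schwartz_add schwartz_scale schwartz_times_id schwartz_deriv)

lemma schwartz_foldr_shifted_euler:
  "schwartz F \<Longrightarrow> schwartz (foldr (\<lambda>e. shifted_euler v (c e)) es F)"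
  by (induction es) (auto intro: schwartz_shifted_euler)

text \<open>Integration by parts shows that the operator multiplies each moment by a constant.\<close>

lemma power_moment_shifted_euler:
  assumes F: "schwartz F" and s: "\<bar>s\<bar> = 1" and k: "k \<ge> 1"
  shows "real k * power_moment s k m (shifted_euler v c F) =
    (real k * c - real v * real (Suc m)) * power_moment s k m F"
proof -
  note F' = schwartz_deriv[OF F]
  have "power_moment s k m (shifted_euler v c F) =
      (LINT t|lborel. real v * s * (deriv F (s * t ^ k) * t ^ (m + k)) + c * (F (s * t ^ k) * t ^ m))"
    unfolding power_moment_def shifted_euler_def
    by (rule Bochner_Integration.integral_cong) (auto simp: algebra_simps power_add)
  also have "\<dots> = real v * s * power_moment s k (m + k) (deriv F) + c * power_moment s k m F"
    unfolding power_moment_def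
    using integrable_power_moment_integrand[OF F s k] integrable_power_moment_integrand[OF F' s k]
    by simp
  finally have *: "power_moment s k m (shifted_euler v c F) =
      real v * s * power_moment s k (m + k) (deriv F) + c * power_moment s k m F" .
  have "s * real k * power_moment s k (m + k) (deriv F) = - (real (Suc m) * power_moment s k m F)"
    using power_moment_by_parts[OF F s k, of "Suc m"]
    by (simp add: eq_neg_iff_add_eq_0 del: of_nat_Suc)
  then have "real v * (s * real k * power_moment s k (m + k) (deriv F)) =
      real v * (- (real (Suc m) * power_moment s k m F))"
    by (simp only:)
  with * show ?thesis
    by (simp add: algebra_simps)
qed

lemma power_moment_foldr_shifted_euler_eq_0:
  assumes F: "schwartz F" and s: "\<bar>s\<bar> = 1" and k: "k \<ge> 1"
    and 0: "power_moment s k m F = 0 \<or> (\<exists>e\<in>set es. k * e = v * Suc m)"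
  shows "power_moment s k m (foldr (\<lambda>e. shifted_euler v (real e)) es F) = 0"
  using 0
proof (induction es)
  case (Cons e es)
  let ?F = "foldr (\<lambda>e. shifted_euler v (real e)) es F"
  have "(real k * real e - real v * real (Suc m)) * power_moment s k m ?F = 0"
  proof (cases "k * e = v * Suc m")
    case True
    then have "real k * real e = real v * real (Suc m)"
      by (metis of_nat_mult)
    then show ?thesis by simp
  next
    case False
    with Cons show ?thesis by simp
  qed
  then have "real k * power_moment s k m (shifted_euler v (real e) ?F) = 0"
    unfolding power_moment_shifted_euler[OF schwartz_foldr_shifted_euler[OF F] s k] .
  with k show ?case by simp
qed simp

section \<open>Derivatives of a function of a power\<close>

text \<open>For \<open>v > 0\<close>, the operator \<open>P \<mapsto> Q\<close> for which the \<open>v\<close>-th derivative of \<open>P (x ^ v)\<close> is \<open>Q (x ^ v)\<close>.\<close>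

definition power_deriv :: "nat \<Rightarrow> (real \<Rightarrow> real) \<Rightarrow> real \<Rightarrow> real" where
  "power_deriv v P = foldr (\<lambda>e. shifted_euler v (real e)) [1..<v] (\<lambda>t. real v * deriv P t)"

lemma schwartz_power_deriv: "schwartz P \<Longrightarrow> schwartz (power_deriv v P)"
  unfolding power_deriv_def
  by (intro schwartz_foldr_shifted_euler schwartz_scale schwartz_deriv)

lemma schwartz_power_deriv_funpow: "schwartz P \<Longrightarrow> schwartz ((power_deriv v ^^ b) P)"
  by (induction b) (auto intro: schwartz_power_deriv)

text \<open>The first derivative has a factor \<open>x ^ (v - 1)\<close>. Each further one lowers this exponent \<open>e\<close> by one
  and applies the operator with shift \<open>e\<close>, so the shifts run down from \<open>v - 1\<close> and the
  power of \<open>x\<close> is used up after \<open>v\<close> derivatives.\<close>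

lemma deriv_funpow_compose_power_less:
  assumes P: "schwartz P" and "j < v"
  shows "(deriv ^^ Suc j) (\<lambda>x. P (x ^ v)) = (\<lambda>x. x ^ (v - Suc j) *
    foldr (\<lambda>e. shifted_euler v (real e)) [v - j..<v] (\<lambda>t. real v * deriv P t) (x ^ v))"
  using assms(2)
proof (induction j)
  case 0
  have "((\<lambda>x. P (x ^ v)) has_real_derivative x ^ (v - Suc 0) * (real v * deriv P (x ^ v))) (at x)" for x
    by (rule DERIV_cong[OF DERIV_chain2[OF schwartz_DERIV[OF P]]])
      (auto intro!: derivative_eq_intros)
  then show ?case
    by (auto simp: fun_eq_iff intro: DERIV_imp_deriv)
next
  case (Suc j)
  let ?Q = "foldr (\<lambda>e. shifted_euler v (real e)) [v - j..<v] (\<lambda>t. real v * deriv P t)"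
  have Q: "schwartz ?Q"
    by (intro schwartz_foldr_shifted_euler schwartz_scale schwartz_deriv P)
  define e where "e = v - Suc j"
  have e: "e > 0" "v - Suc (Suc j) = e - 1" "v - Suc j = e"
    and upt: "[e..<v] = e # [v - j..<v]"
    using Suc.prems by (auto simp: e_def upt_conv_Cons Suc_diff_Suc)
  have "((\<lambda>x. x ^ e * ?Q (x ^ v)) has_real_derivative
      x ^ (e - 1) * shifted_euler v (real e) ?Q (x ^ v)) (at x)" for x
  proof -
    have Qc: "((\<lambda>x. ?Q (x ^ v)) has_real_derivative deriv ?Q (x ^ v) * (real v * x ^ (v - 1))) (at x)"
      by (rule DERIV_chain2[OF schwartz_DERIV[OF Q]]) (auto intro!: derivative_eq_intros)
    have Pe: "((\<lambda>x. x ^ e) has_real_derivative real e * x ^ (e - 1)) (at x)"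
      by (auto intro!: derivative_eq_intros)
    have pw: "x ^ e * x ^ (v - 1) = x ^ (e - 1) * x ^ v"
      using e(1) Suc.prems by (simp flip: power_add)
    have "real e * x ^ (e - 1) * ?Q (x ^ v) + deriv ?Q (x ^ v) * (real v * x ^ (v - 1)) * x ^ e =
        real e * x ^ (e - 1) * ?Q (x ^ v) + real v * deriv ?Q (x ^ v) * (x ^ e * x ^ (v - 1))"
      by (simp only: mult_ac)
    also have "\<dots> = x ^ (e - 1) * shifted_euler v (real e) ?Q (x ^ v)"
      unfolding pw shifted_euler_def by (simp add: algebra_simps)
    finally show ?thesis
      using DERIV_mult[OF Pe Qc] by simp
  qed
  then have "deriv (\<lambda>x. x ^ e * ?Q (x ^ v)) = (\<lambda>x. x ^ (e - 1) * shifted_euler v (real e) ?Q (x ^ v))"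
    by (auto simp: fun_eq_iff intro: DERIV_imp_deriv)
  moreover have "(deriv ^^ Suc j) (\<lambda>x. P (x ^ v)) = (\<lambda>x. x ^ e * ?Q (x ^ v))"
    using Suc by (simp add: e)
  ultimately show ?case
    by (simp add: e upt)
qed

lemma deriv_funpow_compose_power:
  assumes P: "schwartz P" and v: "v > 0"
  shows "(deriv ^^ (b * v)) (\<lambda>x. P (x ^ v)) = (\<lambda>x. (power_deriv v ^^ b) P (x ^ v))"
proof (induction b)
  case (Suc b)
  have "v = Suc (v - 1)"
    using v by simp
  then have "(deriv ^^ v) (\<lambda>x. Q (x ^ v)) = (\<lambda>x. power_deriv v Q (x ^ v))" if "schwartz Q" for Q
    using deriv_funpow_compose_power_less[OF that, of "v - 1" v] v
    by (simp add: power_deriv_def del: funpow.simps)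
  with Suc P show ?case
    by (simp add: funpow_add schwartz_power_deriv_funpow)
qed simp

lemma deriv_reflect:
  fixes F :: "real \<Rightarrow> real"
  assumes F: "schwartz F" and refl: "\<And>t. F (- t) = a * F t"
  shows "deriv F (- t) = - a * deriv F t"
proof -
  have "((\<lambda>t. F (- t)) has_real_derivative deriv F (- t) * (- 1)) (at t)"
    by (rule DERIV_chain2[OF schwartz_DERIV[OF F]]) (auto intro!: derivative_eq_intros)
  moreover have "((\<lambda>t. F (- t)) has_real_derivative a * deriv F t) (at t)"
    unfolding refl by (rule DERIV_cmult[OF schwartz_DERIV[OF F]])
  ultimately show ?thesis
    using DERIV_unique by force
qed

text \<open>The operator \<open>t \<cdot> d/dt\<close> preserves parity, so only the single unaccompanied derivative in
  \<open>power_deriv\<close> flips it.\<close>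

lemma power_deriv_reflect:
  fixes F :: "real \<Rightarrow> real"
  assumes F: "schwartz F" and refl: "\<And>t. F (- t) = a * F t"
  shows "power_deriv v F (- t) = - a * power_deriv v F t"
proof -
  have "foldr (\<lambda>e. shifted_euler v (real e)) es (\<lambda>t. real v * deriv F t) (- t) =
      - a * foldr (\<lambda>e. shifted_euler v (real e)) es (\<lambda>t. real v * deriv F t) t" for es t
  proof (induction es arbitrary: t)
    case Nil
    then show ?case
      using deriv_reflect[OF F refl, of t] by simp
  next
    case (Cons e es)
    have "schwartz (foldr (\<lambda>e. shifted_euler v (real e)) es (\<lambda>t. real v * deriv F t))"
      by (intro schwartz_foldr_shifted_euler schwartz_scale schwartz_deriv F)
    from deriv_reflect[OF this Cons.IH] Cons.IH show ?case
      by (simp add: shifted_euler_def algebra_simps)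
  qed
  then show ?thesis
    unfolding power_deriv_def .
qed

lemma power_deriv_funpow_reflect:
  assumes F: "schwartz F" and even: "\<And>t. F (- t) = F t"
  shows "(power_deriv v ^^ b) F (- t) = (- 1) ^ b * (power_deriv v ^^ b) F t"
proof (induction b arbitrary: t)
  case (Suc b)
  then show ?case
    using power_deriv_reflect[OF schwartz_power_deriv_funpow[OF F] Suc] by simp
qed (simp add: even)

text \<open>A derivative lowers the degree of a moment along \<open>t ^ k\<close> by \<open>k\<close>; repeating this leaves a degree
  \<open>m < k\<close>. If \<open>m = k - 1\<close>, the integrand is a derivative. Otherwise \<open>v * Suc m / k\<close> is one of
  \<open>1, \<dots>, v - 1\<close>, and the factor of \<open>power_deriv\<close> with this shift annihilates the moment.\<close>

lemma power_moment_power_deriv_funpow_eq_0: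
  assumes F: "schwartz F" and s: "\<bar>s\<bar> = 1" and k: "k \<ge> 1" "k dvd v" "v > 0"
    and "m < b * k"
  shows "power_moment s k m ((power_deriv v ^^ b) F) = 0"
  using \<open>m < b * k\<close>
proof (induction b arbitrary: m)
  case (Suc b)
  let ?F = "(power_deriv v ^^ b) F"
  note sF = schwartz_power_deriv_funpow[OF F, of b v]
  have "power_moment s k m (\<lambda>t. real v * deriv ?F t) = 0 \<or>
      (\<exists>e\<in>set [1..<v]. k * e = v * Suc m)"
  proof (cases "Suc m < k")
    case True
    from k obtain w where w: "v = k * w" by auto
    with k have "w > 0" by auto
    then have "w * Suc m \<ge> 1" "w * Suc m < k * w"
      using True by (simp_all add: mult.commute[of k] del: mult_Suc_right)
    then have "w * Suc m \<in> set [1..<v]"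
      by (simp only: w set_upt atLeastLessThan_iff)
    moreover have "k * (w * Suc m) = v * Suc m"
      by (simp only: w mult.assoc)
    ultimately show ?thesis by blast
  next
    case False
    define p where "p = Suc m - k"
    have m: "m = p + k - 1"
      using False by (simp add: p_def)
    have "real p * power_moment s k (p - 1) ?F = 0"
    proof (cases "p = 0")
      case False
      with Suc.prems have "p - 1 < b * k"
        by (auto simp: p_def)
      with Suc.IH show ?thesis by simp
    qed simp
    with power_moment_by_parts[OF sF s k(1), of p] have "power_moment s k m (deriv ?F) = 0"
      using s k by (auto simp: m)
    moreover have "power_moment s k m (\<lambda>t. real v * deriv ?F t) = real v * power_moment s k m (deriv ?F)"
      unfolding power_moment_def by (simp add: mult.assoc)
    ultimately show ?thesis by simp
  qed
  then have "power_moment s k m (power_deriv v ?F) = 0"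
    unfolding power_deriv_def[of v ?F]
    by (rule power_moment_foldr_shifted_euler_eq_0[OF schwartz_scale[OF schwartz_deriv[OF sF]] s k(1)])
  then show ?case by simp
qed simp

section \<open>Antiderivatives\<close>

lemma deriv_funpow_shifted_euler:
  assumes F: "schwartz F"
  shows "(deriv ^^ b) (shifted_euler v c F) =
    (\<lambda>t. real v * t * (deriv ^^ Suc b) F t + (real (v * b) + c) * (deriv ^^ b) F t)"
proof (induction b)
  case 0
  then show ?case by (simp add: shifted_euler_def fun_eq_iff)
next
  case (Suc b)
  have "((\<lambda>t. real v * t * (deriv ^^ Suc b) F t + (real (v * b) + c) * (deriv ^^ b) F t)
      has_real_derivative real v * t * (deriv ^^ Suc (Suc b)) F t +
        (real (v * Suc b) + c) * (deriv ^^ Suc b) F t) (at t)" for t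
    using schwartz_DERIV[OF schwartz_deriv_funpow[OF F, of b], of t]
      schwartz_DERIV[OF schwartz_deriv_funpow[OF F, of "Suc b"], of t]
    by (auto intro!: derivative_eq_intros simp: algebra_simps)
  then show ?case
    unfolding funpow.simps(2)[of b deriv, unfolded comp_def] Suc
    by (auto simp: fun_eq_iff intro: DERIV_imp_deriv)
qed

text \<open>Commuting \<open>t \<cdot> d/dt\<close> past \<open>(d/dt) ^ b\<close> produces the commutator term \<open>b \<cdot> (d/dt) ^ b\<close>.\<close>

lemma shifted_euler_deriv_funpow:
  assumes F: "schwartz F"
  shows "shifted_euler v c ((deriv ^^ b) F) = (deriv ^^ b) (shifted_euler v (c - real (v * b)) F)"
  unfolding deriv_funpow_shifted_euler[OF F]
  by (simp add: shifted_euler_def fun_eq_iff)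

lemma foldr_shifted_euler_deriv_funpow:
  assumes F: "schwartz F"
  shows "foldr (\<lambda>e. shifted_euler v (c e)) es ((deriv ^^ b) F) =
    (deriv ^^ b) (foldr (\<lambda>e. shifted_euler v (c e - real (v * b))) es F)"
proof (induction es)
  case (Cons e es)
  then show ?case
    using shifted_euler_deriv_funpow[OF schwartz_foldr_shifted_euler[OF F]]
    by (simp del: of_nat_mult)
qed simp

lemma deriv_funpow_scale:
  assumes "schwartz (F :: real \<Rightarrow> real)"
  shows "(deriv ^^ b) (\<lambda>t. a * F t) = (\<lambda>t. a * (deriv ^^ b) F t)"
proof (induction b)
  case (Suc b)
  have "deriv (\<lambda>t. a * (deriv ^^ b) F t) = (\<lambda>t. a * deriv ((deriv ^^ b) F) t)"
    by (intro ext DERIV_imp_deriv DERIV_cmult schwartz_DERIV schwartz_deriv_funpow assms)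
  with Suc show ?case by simp
qed simp

text \<open>At \<open>0\<close> the operator \<open>v \<cdot> t \<cdot> d/dt + c\<close> multiplies the \<open>m\<close>-th Taylor coefficient by \<open>v * m + c\<close>, so it
  preserves the set of nonzero coefficients when \<open>c\<close> is an integer that \<open>v\<close> does not divide.\<close>

lemma deriv_funpow_foldr_shifted_euler_at_0:
  assumes F: "schwartz F" and es: "\<And>e. e \<in> set es \<Longrightarrow> 0 < e \<and> e < v"
  shows "(deriv ^^ m) (foldr (\<lambda>e. shifted_euler v (real e - real (v * b))) es F) 0 \<noteq> 0 \<longleftrightarrow>
    (deriv ^^ m) F 0 \<noteq> 0"
  using es
proof (induction es)
  case (Cons e es)
  let ?F = "foldr (\<lambda>e. shifted_euler v (real e - real (v * b))) es F"
  have "schwartz ?F"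
    by (rule schwartz_foldr_shifted_euler[OF F])
  from deriv_funpow_shifted_euler[OF this]
  have "(deriv ^^ m) (shifted_euler v (real e - real (v * b)) ?F) 0 =
      (real (v * m) + (real e - real (v * b))) * (deriv ^^ m) ?F 0"
    by (simp del: of_nat_mult)
  moreover have "real (v * m) + (real e - real (v * b)) \<noteq> 0"
  proof
    assume "real (v * m) + (real e - real (v * b)) = 0"
    then have "v * m + e = v * b"
      by (simp flip: of_nat_add of_nat_mult)
    then have "(v * m + e) mod v = 0"
      by simp
    then have "v dvd e"
      by (simp add: dvd_eq_mod_eq_0)
    with Cons.prems[of e] show False
      by (auto dest: dvd_imp_le)
  qed
  ultimately show ?case
    using Cons by simp
qed simp

text \<open>Hence \<open>power_deriv v ^^ b\<close> is an honest \<open>b\<close>-th derivative: its commutators with \<open>d/dt\<close> only change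
  the integer shifts, and modulo \<open>v\<close> not at all.\<close>

lemma power_deriv_funpow_antiderivative:
  assumes F: "schwartz F" and v: "v > 0"
  obtains G where "schwartz G" "(power_deriv v ^^ b) F = (deriv ^^ b) G"
    "\<And>m. (deriv ^^ m) G 0 \<noteq> 0 \<longleftrightarrow> (deriv ^^ m) F 0 \<noteq> 0"
proof -
  have "\<exists>G. schwartz G \<and> (power_deriv v ^^ b) F = (deriv ^^ b) G \<and>
    (\<forall>m. (deriv ^^ m) G 0 \<noteq> 0 \<longleftrightarrow> (deriv ^^ m) F 0 \<noteq> 0)"
  proof (induction b)
    case 0
    then show ?case
      using F by (intro exI[of _ F]) simp
  next
    case (Suc b)
    then obtain G where G: "schwartz G" "(power_deriv v ^^ b) F = (deriv ^^ b) G"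
      "\<And>m. (deriv ^^ m) G 0 \<noteq> 0 \<longleftrightarrow> (deriv ^^ m) F 0 \<noteq> 0"
      by blast
    let ?vG = "\<lambda>t. real v * G t"
    let ?H = "foldr (\<lambda>e. shifted_euler v (real e - real (v * Suc b))) [1..<v] ?vG"
    have vG: "schwartz ?vG"
      by (rule schwartz_scale[OF G(1)])
    have "(\<lambda>t. real v * deriv ((deriv ^^ b) G) t) = (deriv ^^ Suc b) ?vG"
      using deriv_funpow_scale[OF G(1), of "Suc b" "real v"] by simp
    then have "(power_deriv v ^^ Suc b) F = (deriv ^^ Suc b) ?H"
      by (simp add: G(2) power_deriv_def foldr_shifted_euler_deriv_funpow[OF vG] del: funpow.simps
          add: funpow.simps(2)[of b "power_deriv v"])
    moreover have "(deriv ^^ m) ?H 0 \<noteq> 0 \<longleftrightarrow> (deriv ^^ m) F 0 \<noteq> 0" for m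
      using v deriv_funpow_foldr_shifted_euler_at_0[OF vG, of "[1..<v]" v m "Suc b"] G(3)[of m]
      by (simp add: deriv_funpow_scale[OF G(1)])
    moreover have "schwartz ?H"
      by (rule schwartz_foldr_shifted_euler[OF vG])
    ultimately show ?case by blast
  qed
  with that show ?thesis by blast
qed

text \<open>For \<open>m = c\<close> the second summand drops out: \<open>(1 + t) * (deriv ^^ Suc c) G t\<close> is a derivative of
  order \<open>c\<close>. The derivatives of lower order are then its iterated integrals.\<close>

lemma deriv_funpow_affine_antiderivative:
  fixes G :: "real \<Rightarrow> real"
  assumes G: "schwartz G"
  shows "(deriv ^^ m) (\<lambda>t. (1 + t) * deriv G t - c * G t) =
    (\<lambda>t. (1 + t) * (deriv ^^ Suc m) G t + (real m - c) * (deriv ^^ m) G t)"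
proof (induction m)
  case 0
  then show ?case by (simp add: fun_eq_iff)
next
  case (Suc m)
  have "((\<lambda>t. (1 + t) * (deriv ^^ Suc m) G t + (real m - c) * (deriv ^^ m) G t)
      has_real_derivative (1 + t) * (deriv ^^ Suc (Suc m)) G t +
        (real (Suc m) - c) * (deriv ^^ Suc m) G t) (at t)" for t
    using schwartz_DERIV[OF schwartz_deriv_funpow[OF G, of m], of t]
      schwartz_DERIV[OF schwartz_deriv_funpow[OF G, of "Suc m"], of t]
    by (auto intro!: derivative_eq_intros simp: algebra_simps)
  then show ?case
    unfolding funpow.simps(2)[of m deriv, unfolded comp_def] Suc
    by (auto simp: fun_eq_iff intro: DERIV_imp_deriv)
qed

section \<open>The Taylorlet\<close>

lemma schwartz_affine_times:
  assumes "schwartz F"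
  shows "schwartz (\<lambda>t::real. (1 + t) * F t)"
  using schwartz_add[OF assms schwartz_times_id[OF assms]] by (simp add: distrib_right)

text \<open>For \<open>s = 1\<close> and \<open>s = -1\<close> the factor \<open>1 + s * t ^ k\<close> splits a moment of order \<open>m\<close> into moments
  of orders \<open>m\<close> and \<open>m + k\<close>, which costs one vanishing moment.\<close>

lemma has_vanishing_moments_affine_times:
  assumes F: "schwartz F"
    and zero: "\<And>s k m. \<bar>s\<bar> = 1 \<Longrightarrow> k \<in> {1..n} \<Longrightarrow> m < k * Suc R \<Longrightarrow> power_moment s k m F = 0"
  shows "has_vanishing_moments R n (\<lambda>t. (1 + t) * F t)"
  unfolding has_vanishing_moments_def
proof (intro ballI allI impI)
  fix s :: real and k m :: nat
  assume "s \<in> {1, -1}" and k: "k \<in> {1..n}" and m: "m < k * R"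
  then have s: "\<bar>s\<bar> = 1" by auto
  have hbi: "has_bochner_integral lborel (\<lambda>t. F (s * t ^ k) * t ^ p) 0" if "p < k * Suc R" for p
    using integrable_power_moment_integrand[OF F s, of k p] zero[OF s k that] k
    by (auto simp: has_bochner_integral_iff power_moment_def)
  have "has_bochner_integral lborel
      (\<lambda>t. F (s * t ^ k) * t ^ m + s * (F (s * t ^ k) * t ^ (m + k))) (0 + s * 0)"
    using m by (intro has_bochner_integral_add has_bochner_integral_mult_right hbi) auto
  then show "has_bochner_integral lborel (\<lambda>t. (1 + s * t ^ k) * F (s * t ^ k) * t ^ m) 0"
    by (simp add: algebra_simps power_add)
qed

lemma I_plus_funpow_affine_times_at_0:
  assumes G: "schwartz G" and "j \<le> R"
  shows "(I_plus ^^ j) (\<lambda>t. (1 + t) * (a * (deriv ^^ Suc R) G t)) 0 =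
    a * ((deriv ^^ Suc (R - j)) G 0 - real j * (deriv ^^ (R - j)) G 0)"
proof -
  let ?U = "\<lambda>t. (1 + t) * deriv G t - real R * G t"
  have U: "schwartz ?U"
    using schwartz_scaled_add[OF G schwartz_affine_times[OF schwartz_deriv[OF G]], of "- real R"]
    by simp
  have "(\<lambda>t. (1 + t) * (a * (deriv ^^ Suc R) G t)) = (deriv ^^ R) (\<lambda>t. a * ?U t)"
    unfolding deriv_funpow_scale[OF U] deriv_funpow_affine_antiderivative[OF G]
    by (simp add: mult_ac)
  then have "(I_plus ^^ j) (\<lambda>t. (1 + t) * (a * (deriv ^^ Suc R) G t)) =
      (deriv ^^ (R - j)) (\<lambda>t. a * ?U t)"
    using I_plus_funpow_deriv_funpow[OF schwartz_scale[OF U] \<open>j \<le> R\<close>] by simp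
  then show ?thesis
    unfolding deriv_funpow_scale[OF U] deriv_funpow_affine_antiderivative[OF G]
    using \<open>j \<le> R\<close> by (simp add: of_nat_diff del: funpow.simps)
qed

theorem theorem5:
  fixes r n v :: nat
    and \<phi> \<phi>\<^sub>n \<phi>\<^sub>n\<^sub>r \<phi>t g :: "real \<Rightarrow> real"
    and h :: "real \<Rightarrow> complex"
    and \<tau> :: "real \<times> real \<Rightarrow> complex"
  assumes "r \<ge> 1" and "n \<ge> 1"
    and "v = Lcm {1..n}"
    and "schwartz \<phi>"
    and "\<forall>t. \<phi> (- t) = \<phi> t"
    and "\<forall>k. (deriv ^^ k) \<phi> 0 \<noteq> 0 \<longleftrightarrow> even k"
    and "\<phi>\<^sub>n = (\<lambda>t. \<phi> (t ^ v))"
    and "\<phi>\<^sub>n\<^sub>r = (\<lambda>t. 1 / fact (2 * r * v) * (deriv ^^ (2 * r * v)) \<phi>\<^sub>n t)"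
    and "\<phi>t = (\<lambda>t. \<phi>\<^sub>n\<^sub>r (root v \<bar>t\<bar>))"
    and "g = (\<lambda>t. (1 + t) * \<phi>t t)"
    and "schwartz h"
    and "(LINT t|lborel. h t) \<noteq> 0"
    and "\<tau> = tensor g h"
  shows "schwartz \<tau> \<and>
         analyzing_taylorlet n (2 * r - 1) \<tau> g h \<and>
         restrictive_taylorlet n (2 * r - 1) \<tau> g h"
proof -
  define R where "R = 2 * r - 1"
  have R: "2 * r = Suc R" and "odd R"
    using \<open>r \<ge> 1\<close> by (auto simp: R_def)
  define a :: real where "a = 1 / fact (2 * r * v)"
  have a: "a \<noteq> 0"
    by (simp add: a_def)
  have v: "v > 0"
    using assms(3) by (auto intro: Nat.gr0I simp: Lcm_0_iff)
  define \<Phi> where "\<Phi> = (power_deriv v ^^ (2 * r)) \<phi>"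
  have \<Phi>: "schwartz \<Phi>"
    unfolding \<Phi>_def by (rule schwartz_power_deriv_funpow[OF assms(4)])
  have even: "\<Phi> (- t) = \<Phi> t" for t
    using power_deriv_funpow_reflect[OF assms(4), of "2 * r" v t] assms(5) by (simp add: \<Phi>_def)
  have "\<phi>t t = a * \<Phi> t" for t
  proof -
    have "\<phi>t t = a * \<Phi> (root v \<bar>t\<bar> ^ v)"
      unfolding assms(7-9) deriv_funpow_compose_power[OF assms(4) v] \<Phi>_def a_def ..
    also have "\<dots> = a * \<Phi> t"
      using v even[of t] by (simp add: abs_if)
    finally show ?thesis .
  qed
  then have g: "g = (\<lambda>t. (1 + t) * (a * \<Phi> t))"
    by (simp add: assms(10))
  have sg: "schwartz g"
    unfolding g by (intro schwartz_affine_times schwartz_scale \<Phi>)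
  have "power_moment s k m (\<lambda>t. a * \<Phi> t) = 0"
    if "\<bar>s\<bar> = 1" "k \<in> {1..n}" "m < k * Suc R" for s k m
  proof -
    have "k dvd v"
      using that(2) assms(3) by (auto intro: dvd_Lcm)
    moreover have "m < 2 * r * k"
      unfolding R using that(3) by (simp add: mult.commute)
    ultimately have "power_moment s k m \<Phi> = 0"
      unfolding \<Phi>_def using that(1,2) v
      by (intro power_moment_power_deriv_funpow_eq_0[OF assms(4)]) auto
    then show ?thesis
      by (simp add: power_moment_def mult.assoc)
  qed
  then have "has_vanishing_moments R n g"
    unfolding g by (rule has_vanishing_moments_affine_times[OF schwartz_scale[OF \<Phi>]])
  then have analyzing: "analyzing_taylorlet n R \<tau> g h"
    using sg assms(11,13) by (simp add: analyzing_taylorlet_def)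
  obtain G where G: "schwartz G" "\<Phi> = (deriv ^^ Suc R) G"
    and G0: "\<And>m. (deriv ^^ m) G 0 \<noteq> 0 \<longleftrightarrow> even m"
    using power_deriv_funpow_antiderivative[OF assms(4) v, of "Suc R"] assms(6)
    unfolding \<Phi>_def R by metis
  have "(I_plus ^^ j) g 0 \<noteq> 0" if "j \<le> R" for j
  proof -
    \<comment> \<open>Exactly one of the two consecutive derivatives of \<open>G\<close> at \<open>0\<close> is nonzero. It is the lower one
      only if \<open>R - j\<close> is even, and then its coefficient \<open>j\<close> is odd.\<close>
    have "(deriv ^^ Suc (R - j)) G 0 - real j * (deriv ^^ (R - j)) G 0 \<noteq> 0"
    proof (cases "even (R - j)")
      case True
      then have "odd j"
        using \<open>odd R\<close> \<open>j \<le> R\<close> by simp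
      then have "j \<noteq> 0" by (rule odd_pos[THEN gr_implies_not0])
      with True G0[of "R - j"] G0[of "Suc (R - j)"] show ?thesis by simp
    next
      case False
      with G0[of "R - j"] G0[of "Suc (R - j)"] show ?thesis by simp
    qed
    with a show ?thesis
      unfolding g G(2) I_plus_funpow_affine_times_at_0[OF G(1) that] by simp
  qed
  with analyzing assms(12) have "restrictive_taylorlet n R \<tau> g h"
    by (simp add: restrictive_taylorlet_def)
  moreover have "schwartz \<tau>"
    unfolding assms(13) by (rule schwartz_tensor[OF sg assms(11)])
  ultimately show ?thesis
    using analyzing by (simp add: R_def)
qed

end
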